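(* Let $A$ be a generalized Cartan matrix with associated data $\mathfrak h_{\mathbb R}^*,\Pi,W,\overline C$, let $\mu\in\overline C$, and let $H$ be the convex hull of $W\mu$. For $I\subseteq\Pi$ let $F_I$ be the convex hull of $W_I\mu$. Then the map $I\mapsto F_I$ from the set of all $\mu$-connected subsets of $\Pi$ to the set $\mathcal F\setminus\{\emptyset\}$ of all nonempty fundamental faces of $H$ is an isomorphism of partially ordered sets (both sets being ordered by inclusion).
   Context: Let $A=(a_{ij})_{i,j=1}^m$ be a generalized Cartan matrix (integral, $a_{ii}=2$, $a_{ij}\le 0$ for $i\ne j$, $a_{ij}=0\Rightarrow a_{ji}=0$) of rank $l$. Let $(\mathfrak h_{\mathbb R},\Pi,\Pi^\vee)$ be a realization of $A$ over $\mathbb R$: $\mathfrak h_{\mathbb R}$ is a real vector space of dimension $2m-l$, and $\Pi=\{\alpha_1,\dots,\alpha_m\}\subset\mathfrak h_{\mathbb R}^*$ and $\Pi^\vee=\{\alpha_1^\vee,\dots,\alpha_m^\vee\}\subset\mathfrak h_{\mathbb R}$ are linearly independent with $\langle\alpha_j,\alpha_i^\vee\rangle=a_{ij}$. The Weyl group $W\subset GL(\mathfrak h_{\mathbb R}^* )$ is generated by the reflections $r_{\alpha_i}(\eta)=\eta-\langle\eta,\alpha_i^\vee\rangle\alpha_i$. For $I\subseteq\Pi$, $W_I$ is the subgroup generated by $r_\alpha$, $\alpha\in I$. The fundamental chamber is $\overline C=\{\eta\in\mathfrak h_{\mathbb R}^*\mid\langle\eta,\alpha^\vee\rangle\ge 0\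 \forall\alpha\in\Pi\}$. Set $J_0=\{\alpha\in\Pi\mid\langle\mu,\alpha^\vee\rangle=0\}$. Connected components of a subset of $\Pi$ are taken in the Dynkin diagram of $A$ (distinct $\alpha,\beta\in\Pi$ are adjacent iff $\langle\alpha,\beta^\vee\rangle\ne 0$). A subset $I\subseteq\Pi$ is $\mu$-connected if no connected component of $I$ is contained in $J_0$ (the empty set is $\mu$-connected). A face of the convex set $H$ is a convex subset $F\subseteq H$ such that every closed line segment in $H$ having a relative interior point in $F$ has both endpoints in $F$ (so $\emptyset$ and $H$ are faces). A face $F$ is fundamental if $F=\emptyset$ or $\operatorname{ri}(F)\cap\overline C\ne\emptyset$, where $\operatorname{ri}$ denotes relative interior. $\mathcal F$ is the set of fundamental faces. *)

theory Defs
  imports "HOL-Analysis.Analysis" "HOL-Algebra.Generated_Groups"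
begin

definition gen_cartan_matrix :: "int^'m^'m \<Rightarrow> bool" where
  "gen_cartan_matrix A \<longleftrightarrow>
     (\<forall>i. A $ i $ i = 2) \<and>
     (\<forall>i j. i \<noteq> j \<longrightarrow> A $ i $ j \<le> 0) \<and>
     (\<forall>i j. A $ i $ j = 0 \<longrightarrow> A $ j $ i = 0)"

text \<open>
  The type \<open>'h\<close> is the finite-dimensional real vector space of the realization. Its dual is
  \<open>'h \<Rightarrow>\<^sub>L real\<close>: in finite dimension every linear functional is bounded, and the
  operator norm induces the usual topology, so \<open>rel_interior\<close> is the usual relative interior.
  The inner product of \<open>'h\<close> plays no role.
\<close>

definition realization ::
    "int^'m^'m \<Rightarrow> ('m \<Rightarrow> ('h::euclidean_space \<Rightarrow>\<^sub>L real)) \<Rightarrow> ('m \<Rightarrow> 'h) \<Rightarrow> bool" where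
  "realization A \<alpha> \<alpha>v \<longleftrightarrow>
     DIM('h) = 2 * CARD('m) - rank (map_matrix real_of_int A) \<and>
     inj \<alpha> \<and> independent (range \<alpha>) \<and>
     inj \<alpha>v \<and> independent (range \<alpha>v) \<and>
     (\<forall>i j. blinfun_apply (\<alpha> j) (\<alpha>v i) = real_of_int (A $ i $ j))"

text \<open>
  In the following \<open>\<alpha>\<close> and \<open>\<alpha>v\<close> are the families of simple roots and
  simple coroots, so the set of simple roots is \<open>range \<alpha>\<close>.
\<close>

definition coroot ::
    "('m \<Rightarrow> ('h::euclidean_space \<Rightarrow>\<^sub>L real)) \<Rightarrow> ('m \<Rightarrow> 'h) \<Rightarrow> ('h \<Rightarrow>\<^sub>L real) \<Rightarrow> 'h" where
  "coroot \<alpha> \<alpha>v \<beta> = \<alpha>v (the_inv \<alpha> \<beta>)"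

definition simple_reflection ::
    "('m \<Rightarrow> ('h::euclidean_space \<Rightarrow>\<^sub>L real)) \<Rightarrow> ('m \<Rightarrow> 'h) \<Rightarrow>
     ('h \<Rightarrow>\<^sub>L real) \<Rightarrow> ('h \<Rightarrow>\<^sub>L real) \<Rightarrow> ('h \<Rightarrow>\<^sub>L real)" where
  "simple_reflection \<alpha> \<alpha>v \<beta> \<eta> = \<eta> - blinfun_apply \<eta> (coroot \<alpha> \<alpha>v \<beta>) *\<^sub>R \<beta>"

definition general_linear_group :: "('v::real_vector \<Rightarrow> 'v) monoid" where
  "general_linear_group =
     \<lparr>carrier = {f. linear f \<and> bij f}, mult = (\<lambda>f g. f \<circ> g), one = id\<rparr>"

definition parabolic_subgroup ::
    "('m \<Rightarrow> ('h::euclidean_space \<Rightarrow>\<^sub>L real)) \<Rightarrow> ('m \<Rightarrow> 'h) \<Rightarrow>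
     ('h \<Rightarrow>\<^sub>L real) set \<Rightarrow> (('h \<Rightarrow>\<^sub>L real) \<Rightarrow> ('h \<Rightarrow>\<^sub>L real)) set" where
  "parabolic_subgroup \<alpha> \<alpha>v I = generate general_linear_group (simple_reflection \<alpha> \<alpha>v ` I)"

definition weyl_group ::
    "('m \<Rightarrow> ('h::euclidean_space \<Rightarrow>\<^sub>L real)) \<Rightarrow> ('m \<Rightarrow> 'h) \<Rightarrow>
     (('h \<Rightarrow>\<^sub>L real) \<Rightarrow> ('h \<Rightarrow>\<^sub>L real)) set" where
  "weyl_group \<alpha> \<alpha>v = parabolic_subgroup \<alpha> \<alpha>v (range \<alpha>)"

definition fundamental_chamber ::
    "('m \<Rightarrow> ('h::euclidean_space \<Rightarrow>\<^sub>L real)) \<Rightarrow> ('m \<Rightarrow> 'h) \<Rightarrow> ('h \<Rightarrow>\<^sub>L real) set" where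
  "fundamental_chamber \<alpha> \<alpha>v = {\<eta>. \<forall>\<beta>\<in>range \<alpha>. 0 \<le> blinfun_apply \<eta> (coroot \<alpha> \<alpha>v \<beta>)}"

definition dynkin_edges ::
    "('m \<Rightarrow> ('h::euclidean_space \<Rightarrow>\<^sub>L real)) \<Rightarrow> ('m \<Rightarrow> 'h) \<Rightarrow> ('h \<Rightarrow>\<^sub>L real) rel" where
  "dynkin_edges \<alpha> \<alpha>v =
     {(\<beta>, \<gamma>). \<beta> \<in> range \<alpha> \<and> \<gamma> \<in> range \<alpha> \<and> \<beta> \<noteq> \<gamma> \<and> blinfun_apply \<beta> (coroot \<alpha> \<alpha>v \<gamma>) \<noteq> 0}"

text \<open>For a generalized Cartan matrix the edge relation is symmetric, so these are
  the connected components of the subdiagram induced on \<open>I\<close>.\<close>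

definition dynkin_components ::
    "('m \<Rightarrow> ('h::euclidean_space \<Rightarrow>\<^sub>L real)) \<Rightarrow> ('m \<Rightarrow> 'h) \<Rightarrow>
     ('h \<Rightarrow>\<^sub>L real) set \<Rightarrow> ('h \<Rightarrow>\<^sub>L real) set set" where
  "dynkin_components \<alpha> \<alpha>v I = (\<lambda>\<beta>. (dynkin_edges \<alpha> \<alpha>v \<inter> I \<times> I)\<^sup>* `` {\<beta>}) ` I"

definition orthogonal_simple_roots ::
    "('m \<Rightarrow> ('h::euclidean_space \<Rightarrow>\<^sub>L real)) \<Rightarrow> ('m \<Rightarrow> 'h) \<Rightarrow>
     ('h \<Rightarrow>\<^sub>L real) \<Rightarrow> ('h \<Rightarrow>\<^sub>L real) set" where
  "orthogonal_simple_roots \<alpha> \<alpha>v \<mu> = {\<beta> \<in> range \<alpha>. blinfun_apply \<mu> (coroot \<alpha> \<alpha>v \<beta>) = 0}"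

definition weight_connected ::
    "('m \<Rightarrow> ('h::euclidean_space \<Rightarrow>\<^sub>L real)) \<Rightarrow> ('m \<Rightarrow> 'h) \<Rightarrow>
     ('h \<Rightarrow>\<^sub>L real) \<Rightarrow> ('h \<Rightarrow>\<^sub>L real) set \<Rightarrow> bool" where
  "weight_connected \<alpha> \<alpha>v \<mu> I \<longleftrightarrow>
     I \<subseteq> range \<alpha> \<and>
     (\<forall>K\<in>dynkin_components \<alpha> \<alpha>v I. \<not> K \<subseteq> orthogonal_simple_roots \<alpha> \<alpha>v \<mu>)"

definition orbit_hull ::
    "('v::real_vector \<Rightarrow> 'v) set \<Rightarrow> 'v \<Rightarrow> 'v set" where
  "orbit_hull G \<mu> = convex hull ((\<lambda>w. w \<mu>) ` G)"

definition fundamental_faces ::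
    "('m \<Rightarrow> ('h::euclidean_space \<Rightarrow>\<^sub>L real)) \<Rightarrow> ('m \<Rightarrow> 'h) \<Rightarrow>
     ('h \<Rightarrow>\<^sub>L real) set \<Rightarrow> ('h \<Rightarrow>\<^sub>L real) set set" where
  "fundamental_faces \<alpha> \<alpha>v H =
     {F. F face_of H \<and> (F = {} \<or> rel_interior F \<inter> fundamental_chamber \<alpha> \<alpha>v \<noteq> {})}"

definition poset_isomorphism :: "('a::order \<Rightarrow> 'b::order) \<Rightarrow> 'a set \<Rightarrow> 'b set \<Rightarrow> bool" where
  "poset_isomorphism f S T \<longleftrightarrow> bij_betw f S T \<and> (\<forall>x\<in>S. \<forall>y\<in>S. x \<le> y \<longleftrightarrow> f x \<le> f y)"

end

theory Submission
  imports Defs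
begin

text \<open>
  The orbit \<open>W\<mu>\<close> is analysed as a numbers game. Call a point reachable if it is obtained from
  \<open>\<mu>\<close> by reflections each of which subtracts a positive multiple of a simple root. A confluence
  argument, reducing to rank two, shows that reflecting at a negative coordinate undoes one step of
  such a descent; hence the whole orbit is reachable and lies in \<open>\<mu> - Q\<^sub>+\<close>, and every orbit point
  climbs back to \<open>\<mu>\<close>. Looking at the supports of \<open>\<mu> - x\<close>, it follows that the hulls \<open>F\<^sub>I\<close> are
  faces and that these supports are \<open>\<mu>\<close>-connected. If \<open>x \<in> F\<^sub>I\<close> is dominant and \<open>\<mu> - x\<close> has full
  support \<open>I\<close>, then the smallest face containing \<open>x\<close> is closed under climbing, contains \<open>\<mu>\<close>, and is
  \<open>W\<^sub>I\<close>-invariant, so it is \<open>F\<^sub>I\<close>; hence \<open>x\<close> lies in the relative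
  interior of \<open>F\<^sub>I\<close>. For \<open>\<mu>\<close>-connected \<open>I\<close> one is found by enlarging the support one simple root at
  a time.
\<close>

section \<open>Faces and relative interiors\<close>

text \<open>Positive weights need not sum to 1, so pairings with a coroot can serve as weights as
  they stand.\<close>

lemma convex_weightedE:
  assumes "convex S" "a \<in> S" "b \<in> S" "s > 0" "t > 0"
  obtains z where "z \<in> S" "s *\<^sub>R a + t *\<^sub>R b = (s + t) *\<^sub>R z"
proof
  show "(s / (s + t)) *\<^sub>R a + (t / (s + t)) *\<^sub>R b \<in> S"
    using assms by (intro convexD) (auto simp flip: add_divide_distrib)
  show "s *\<^sub>R a + t *\<^sub>R b = (s + t) *\<^sub>R ((s / (s + t)) *\<^sub>R a + (t / (s + t)) *\<^sub>R b)"
    using assms by (simp add: scaleR_right_distrib)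
qed

lemma face_of_weightedD:
  assumes "T face_of S" "a \<in> S" "b \<in> S" "z \<in> T" "s > 0" "t > 0"
    and "s *\<^sub>R a + t *\<^sub>R b = (s + t) *\<^sub>R z"
  shows "a \<in> T"
proof (cases "a = b")
  case True
  then have "(s + t) *\<^sub>R a = (s + t) *\<^sub>R z"
    using assms(7) by (simp add: scaleR_left_distrib)
  then show ?thesis
    using assms by simp
next
  case False
  define u where "u = t / (s + t)"
  have u: "0 < u" "u < 1" "1 - u = s / (s + t)"
    using assms by (auto simp: u_def field_simps)
  have "z = (1 / (s + t)) *\<^sub>R ((s + t) *\<^sub>R z)"
    using assms by simp
  also have "\<dots> = (1 - u) *\<^sub>R a + u *\<^sub>R b"
    unfolding assms(7)[symmetric] u(3) by (simp add: u_def scaleR_right_distrib)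
  finally have "z \<in> open_segment a b"
    using u False by (auto simp: in_segment)
  then show ?thesis
    using face_ofD assms by blast
qed

text \<open>If \<open>x\<close> lay on the relative boundary, a supporting hyperplane would cut out
  a face through \<open>x\<close> smaller than \<open>S\<close>. The embedding \<open>h\<close>
  supplies the inner product for this argument.\<close>

lemma rel_interior_faceI:
  fixes h :: "'a::real_normed_vector \<Rightarrow> 'b::euclidean_space"
    and S :: "'a set"
  assumes h: "bounded_linear h" "inj h"
    and S: "convex S" "x \<in> S"
    and faces: "\<And>T. T face_of S \<Longrightarrow> x \<in> T \<Longrightarrow> S \<subseteq> T"
  shows "x \<in> rel_interior S"
proof -
  have "linear h"
    using h(1) by (simp add: bounded_linear.linear)
  have "h x \<in> rel_interior (h ` S)"
  proof (rule ccontr)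
    assume "h x \<notin> rel_interior (h ` S)"
    moreover have conv: "convex (h ` S)"
      using S(1) \<open>linear h\<close> by (rule convex_linear_image[rotated])
    ultimately obtain a where a: "\<And>y. y \<in> h ` S \<Longrightarrow> a \<bullet> h x \<le> a \<bullet> y"
        "\<And>y. y \<in> rel_interior (h ` S) \<Longrightarrow> a \<bullet> h x < a \<bullet> y"
      using supporting_hyperplane_rel_boundary[OF conv imageI[OF S(2)]] by metis
    define T where "T = {y \<in> S. a \<bullet> h y = a \<bullet> h x}"
    have "h ` S \<inter> {y. a \<bullet> y = a \<bullet> h x} face_of h ` S"
      by (rule face_of_Int_supporting_hyperplane_ge[OF conv a(1)])
    moreover have "h ` S \<inter> {y. a \<bullet> y = a \<bullet> h x} = h ` T"
      by (auto simp: T_def)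
    ultimately have "T face_of S"
      using face_of_linear_image[OF \<open>linear h\<close> h(2)] by simp
    then have "S \<subseteq> T"
      using faces S(2) by (simp add: T_def)
    moreover obtain y where "y \<in> rel_interior (h ` S)"
      using rel_interior_eq_empty[OF conv] S(2) by auto
    moreover from this obtain z where "z \<in> S" "y = h z"
      using rel_interior_subset by blast
    ultimately show False
      using a(2)[of y] by (auto simp: T_def)
  qed
  then obtain V where V: "open V" "h x \<in> V" "V \<inter> affine hull (h ` S) \<subseteq> h ` S"
    unfolding mem_rel_interior by blast
  \<comment> \<open>Linear maps commute with affine hulls and \<open>h\<close> is injective and
    continuous, so the neighbourhood of \<open>h x\<close> pulls back to one of
    \<open>x\<close>.\<close>
  have "h -` V \<inter> affine hull S \<subseteq> S"
  proof
    fix y assume "y \<in> h -` V \<inter> affine hull S"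
    then have "h y \<in> h ` S"
      using V(3) affine_hull_linear_image[OF h(1), of S] by blast
    then show "y \<in> S"
      using h(2) by (auto dest: injD)
  qed
  moreover have "open (h -` V)"
    using V(1) h(1) by (intro open_vimage) (auto intro: linear_continuous_on)
  ultimately show ?thesis
    unfolding mem_rel_interior using V(2) S(2) by blast
qed

text \<open>The identification of the dual with \<open>'h\<close> through the standard basis; it
  serves as the embedding \<open>h\<close> in \<open>rel_interior_faceI\<close>.\<close>

lemma bounded_linear_blinfun_coordinates:
  "bounded_linear (\<lambda>f::'h::euclidean_space \<Rightarrow>\<^sub>L real. \<Sum>b\<in>Basis. blinfun_apply f b *\<^sub>R b)"
  by (intro bounded_linear_sum bounded_linear_scaleR_const blinfun.bounded_linear_left)

lemma inj_blinfun_coordinates: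
  "inj (\<lambda>f::'h::euclidean_space \<Rightarrow>\<^sub>L real. \<Sum>b\<in>Basis. blinfun_apply f b *\<^sub>R b)"
proof (rule injI)
  fix f g :: "'h \<Rightarrow>\<^sub>L real"
  assume eq: "(\<Sum>b\<in>Basis. blinfun_apply f b *\<^sub>R b) = (\<Sum>b\<in>Basis. blinfun_apply g b *\<^sub>R b)"
  show "f = g"
  proof (rule blinfun_euclidean_eqI)
    fix b :: 'h assume "b \<in> Basis"
    then show "blinfun_apply f b = blinfun_apply g b"
      using arg_cong[OF eq, of "\<lambda>v. v \<bullet> b"] by simp
  qed
qed

section \<open>Reflections and the rank two case\<close>

text \<open>\<open>'v\<close> stands for the dual space and \<open>cor i\<close> for pairing with
  the i-th coroot. Labelling roots by indices turns sets of simple roots into index sets.\<close>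

locale cartan_reflections =
  fixes A :: "int^'m^'m"
    and \<alpha> :: "'m \<Rightarrow> 'v::real_vector"
    and cor :: "'m \<Rightarrow> 'v \<Rightarrow> real"
  assumes cartan: "gen_cartan_matrix A"
    and inj_root: "inj \<alpha>"
    and independent_roots: "independent (range \<alpha>)"
    and linear_cor: "linear (cor i)"
    and cor_root: "cor i (\<alpha> j) = real_of_int (A $ i $ j)"
begin

definition reflect :: "'m \<Rightarrow> 'v \<Rightarrow> 'v" where
  "reflect i x = x - cor i x *\<^sub>R \<alpha> i"

lemma cartan_diag [simp]: "A $ i $ i = 2"
  and cartan_offdiag: "i \<noteq> j \<Longrightarrow> A $ i $ j \<le> 0"
  and cartan_zero_sym: "A $ i $ j = 0 \<Longrightarrow> A $ j $ i = 0"
  using cartan by (auto simp: gen_cartan_matrix_def)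

lemma cor_simps:
  "cor i (x + y) = cor i x + cor i y"
  "cor i (x - y) = cor i x - cor i y"
  "cor i (c *\<^sub>R x) = c * cor i x"
  "cor i (sum f S) = (\<Sum>k\<in>S. cor i (f k))"
  using linear_cor[of i] by (simp_all add: linear_add linear_diff linear_scale linear_sum)

lemma cor_reflect: "cor i (reflect j x) = cor i x - cor j x * real_of_int (A $ i $ j)"
  by (simp add: reflect_def cor_simps cor_root)

lemma cor_reflect_same [simp]: "cor i (reflect i x) = - cor i x"
  by (simp add: cor_reflect)

lemma reflect_reflect [simp]: "reflect i (reflect i x) = x"
  by (simp add: reflect_def cor_simps cor_root)

lemma reflect_fixed: "cor i x = 0 \<Longrightarrow> reflect i x = x"
  by (simp add: reflect_def)

lemma linear_reflect: "linear (reflect i)"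
  by (rule linearI) (simp_all add: reflect_def cor_simps algebra_simps)

lemma inj_reflect: "inj (reflect i)"
  by (metis injI reflect_reflect)

lemma bij_reflect: "bij (reflect i)"
  by (metis bijI inj_reflect reflect_reflect surjI)

section \<open>Firing sequences of the numbers game\<close>

text \<open>A legal play of Mozes's numbers game, head of the list first: a node may fire only while
  its coordinate is negative. The position after the play is
  \<open>fold reflect w x\<close>.\<close>

primrec fires :: "'m list \<Rightarrow> 'v \<Rightarrow> bool" where
  "fires [] x \<longleftrightarrow> True"
| "fires (i # w) x \<longleftrightarrow> cor i x < 0 \<and> fires w (reflect i x)"

primrec alternating :: "nat \<Rightarrow> 'm \<Rightarrow> 'm \<Rightarrow> 'm list" where
  "alternating 0 i j = []"
| "alternating (Suc n) i j = i # alternating n j i"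

lemma length_alternating [simp]: "length (alternating n i j) = n"
  by (induction n arbitrary: i j) auto

lemma of_int_product_ge_4: "4 \<le> real_of_int a * real_of_int b \<longleftrightarrow> 4 \<le> a * b"
  by (metis of_int_le_iff of_int_mult of_int_numeral)

text \<open>Once the product of the two off-diagonal entries is at least 4, the negative coordinate
  stays dominant: the inequality below is preserved with the roles of the two indices swapped.\<close>

lemma fires_alternating:
  assumes "i \<noteq> j" "A $ i $ j * A $ j $ i \<ge> 4"
    and "cor i x < 0" "cor j x > 0"
    and "2 * cor j x \<le> real_of_int (A $ j $ i) * cor i x"
  shows "fires (alternating n i j) x"
  using assms
proof (induction n arbitrary: i j x)
  case 0
  then show ?case by simp
next
  case (Suc n)
  define a b where "a = - real_of_int (A $ i $ j)" and "b = - real_of_int (A $ j $ i)"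
  have ab: "a \<ge> 0" "b \<ge> 0" "a * b \<ge> 4"
    using Suc.prems(1,2) cartan_offdiag[of i j] cartan_offdiag[of j i]
    by (auto simp: a_def b_def of_int_product_ge_4)
  have y: "cor j (reflect i x) = cor j x + b * cor i x"
    by (simp add: cor_reflect b_def)
  have 1: "2 * cor j x \<le> - (b * cor i x)"
    using Suc.prems(5) by (simp add: b_def)
  then have 2: "2 * cor j (reflect i x) \<le> b * cor i x"
    using y by simp
  have neg: "cor j (reflect i x) < 0"
    using y 1 Suc.prems(4) by simp
  have "a * (2 * cor j (reflect i x)) \<le> a * (b * cor i x)"
    using 2 ab(1) by (rule mult_left_mono)
  also have "\<dots> \<le> 4 * cor i x"
    unfolding mult.assoc[symmetric]
    by (rule mult_right_mono_neg[OF ab(3)]) (use Suc.prems(3) in simp)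
  finally have "2 * cor i (reflect i x) \<le> real_of_int (A $ i $ j) * cor j (reflect i x)"
    unfolding cor_reflect_same a_def by linarith
  moreover have "4 \<le> A $ j $ i * A $ i $ j"
    using Suc.prems(2) by (simp only: mult.commute)
  ultimately have "fires (alternating n j i) (reflect i x)"
    using Suc.prems(1,3) neg by (intro Suc.IH) simp_all
  then show ?case
    using Suc.prems(3) by simp
qed

text \<open>From a point that is strictly negative on both nodes, the two alternating firing sequences
  either never stop or meet after the same number of steps (the longest element of a finite
  dihedral group).\<close>

lemma fires_dihedral:
  assumes "i \<noteq> j" "cor i x < 0" "cor j x < 0"
  shows "(\<forall>n. \<exists>w. length w = n \<and> fires (j # w) x) \<or>
    (\<exists>u w. fires (i # u) x \<and> fires (j # w) x \<and> length u = length w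
       \<and> fold reflect (i # u) x = fold reflect (j # w) x)"
proof (cases "A $ i $ j * A $ j $ i \<ge> 4")
  case True
  define a b where "a = - real_of_int (A $ i $ j)" and "b = - real_of_int (A $ j $ i)"
  have ab: "a \<ge> 0" "b \<ge> 0" "a * b \<ge> 4"
    using assms True cartan_offdiag[of i j] cartan_offdiag[of j i]
    by (auto simp: a_def b_def of_int_product_ge_4)
  have y: "cor i (reflect j x) = cor i x + a * cor j x"
    by (simp add: cor_reflect a_def)
  \<comment> \<open>After \<open>j\<close> has fired, the position meets the hypotheses of
    \<open>fires_alternating\<close> with \<open>i\<close> next, so plays starting with
    \<open>j\<close> can have any length.\<close>
  have "cor i (reflect j x) < 0"
    using y ab assms by (simp add: add_neg_nonpos mult_nonneg_nonpos)
  moreover have "2 * cor j (reflect j x) \<le> real_of_int (A $ j $ i) * cor i (reflect j x)"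
  proof -
    have "b * cor i x \<le> 0"
      using ab assms by (simp add: mult_nonneg_nonpos)
    moreover have "a * b * cor j x \<le> 4 * cor j x"
      using ab(3) assms by (intro mult_right_mono_neg) auto
    moreover have "real_of_int (A $ j $ i) * cor i (reflect j x) = - (b * cor i x) - a * b * cor j x"
      using y by (simp add: b_def algebra_simps)
    ultimately show ?thesis
      using assms unfolding cor_reflect_same by linarith
  qed
  ultimately have "fires (alternating n i j) (reflect j x)" for n
    using assms True by (intro fires_alternating) auto
  then have "fires (j # alternating n i j) x" for n
    using assms by simp
  then show ?thesis
    using length_alternating by blast
next
  case False
  define a b where "a = - (A $ i $ j)" and "b = - (A $ j $ i)"
  have A: "A $ i $ j = - a" "A $ j $ i = - b"
    by (simp_all add: a_def b_def)
  have ab: "a \<ge> 0" "b \<ge> 0" "a * b < 4"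
    using False assms cartan_offdiag[of i j] cartan_offdiag[of j i] by (auto simp: a_def b_def)
  have zero: "a = 0 \<longleftrightarrow> b = 0"
    using cartan_zero_sym unfolding a_def b_def by fastforce
  have bound: "a \<le> 3 \<and> b \<le> 3"
  proof (cases "a = 0")
    case False
    then have "a \<ge> 1" "b \<ge> 1"
      using ab zero by linarith+
    then have "a * 1 \<le> a * b" "1 * b \<le> a * b"
      using mult_left_mono[of 1 b a] mult_right_mono[of 1 a b] by simp_all
    then show ?thesis
      using ab by linarith
  qed (use zero in simp)
  have "a \<in> {0,1,2,3}" "b \<in> {0,1,2,3}"
    using bound ab by auto
  \<comment> \<open>The finite rank two types A1 x A1, A2, B2 and G2. Their longest elements have
    length 2, 3, 4 and 6, which is the value of \<open>Suc n\<close> in each case below.\<close>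
  then have cases: "a = 0 \<and> b = 0 \<or> a = 1 \<and> b = 1 \<or> a = 1 \<and> b = 2 \<or> a = 2 \<and> b = 1
    \<or> a = 1 \<and> b = 3 \<or> a = 3 \<and> b = 1"
    using ab zero by auto
  define p q where "p = cor i x" and "q = cor j x"
  \<comment> \<open>Both plays stay among the points \<open>y s t\<close>, so following them is
    arithmetic with \<open>p\<close> and \<open>q\<close>.\<close>
  define y where "y s t = x + s *\<^sub>R \<alpha> i + t *\<^sub>R \<alpha> j" for s t
  have y0: "x = y 0 0" and y_eqI: "s = s' \<Longrightarrow> t = t' \<Longrightarrow> y s t = y s' t'" for s t s' t'
    by (simp_all add: y_def)
  have y: "cor i (y s t) = p + 2 * s - real_of_int a * t"
    "cor j (y s t) = q + 2 * t - real_of_int b * s"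
    "reflect i (y s t) = y (real_of_int a * t - s - p) t"
    "reflect j (y s t) = y s (real_of_int b * s - t - q)" for s t
    by (simp_all add: y_def p_def q_def A reflect_def cor_simps cor_root algebra_simps)
      (simp_all only: mult_2_right scaleR_left_distrib)
  have neg: "p < 0" "q < 0"
    using assms by (simp_all add: p_def q_def)
  from cases have "\<exists>n. fires (alternating (Suc n) i j) x \<and> fires (alternating (Suc n) j i) x \<and>
       fold reflect (alternating (Suc n) i j) x = fold reflect (alternating (Suc n) j i) x"
  proof (elim disjE conjE)
    assume "a = 0" "b = 0"
    then show ?thesis
      unfolding y0 using neg by (intro exI[of _ "Suc 0"]) (simp add: y)
  next
    assume "a = 1" "b = 1"
    then show ?thesis
      unfolding y0 using neg by (intro exI[of _ "Suc (Suc 0)"]) (simp add: y)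
  next
    assume "a = 1" "b = 2"
    then show ?thesis
      unfolding y0 using neg by (intro exI[of _ "Suc (Suc (Suc 0))"]) (simp add: y)
  next
    assume "a = 2" "b = 1"
    then show ?thesis
      unfolding y0 using neg by (intro exI[of _ "Suc (Suc (Suc 0))"]) (simp add: y)
  next
    assume "a = 1" "b = 3"
    then show ?thesis
      unfolding y0 using neg by (intro exI[of _ "Suc (Suc (Suc (Suc (Suc 0))))"]) (simp add: y)
  next
    assume "a = 3" "b = 1"
    then show ?thesis
      unfolding y0 using neg by (intro exI[of _ "Suc (Suc (Suc (Suc (Suc 0))))"]) (simp add: y)
  qed
  then obtain n where n: "fires (alternating (Suc n) i j) x" "fires (alternating (Suc n) j i) x"
      "fold reflect (alternating (Suc n) i j) x = fold reflect (alternating (Suc n) j i) x"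
    by (elim exE conjE)
  show ?thesis
    by (intro disjI2 exI[of _ "alternating n j i"] exI[of _ "alternating n i j"])
      (use n in simp)
qed

end

section \<open>The orbit of a dominant weight\<close>

locale dominant_weight = cartan_reflections A \<alpha> cor
  for A :: "int^'m^'m"
    and \<alpha> :: "'m \<Rightarrow> 'v::real_vector"
    and cor :: "'m \<Rightarrow> 'v \<Rightarrow> real" +
  fixes \<mu> :: 'v
  assumes dominant: "cor i \<mu> \<ge> 0"
begin

text \<open>The index counts the steps; it is the induction measure for \<open>ascent\<close> and,
  through it, bounds the length of every play from the point.\<close>

inductive descends :: "nat \<Rightarrow> 'v \<Rightarrow> bool" where
  start: "descends 0 \<mu>"
| step: "descends n x \<Longrightarrow> cor i x > 0 \<Longrightarrow> descends (Suc n) (reflect i x)"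

text \<open>A play read backwards is a descent, since \<open>reflect i\<close> is an involution that
  changes the sign of the i-th coordinate.\<close>

lemma descends_fires:
  assumes "fires w x" "descends n (fold reflect w x)"
  shows "descends (n + length w) x"
  using assms
proof (induction w arbitrary: x)
  case Nil
  then show ?case by simp
next
  case (Cons i w)
  then have "descends (n + length w) (reflect i x)"
    by simp
  then have "descends (Suc (n + length w)) (reflect i (reflect i x))"
    using Cons.prems by (intro step) auto
  then show ?case
    by simp
qed

text \<open>Every negative coordinate can be fired first on the way back to \<open>\<mu>\<close>, with the same total
  number of steps: if the last step of the given descent used another node \<open>j\<close>, both ways up are
  completed to meet at the same point by the rank two analysis.\<close>

lemma ascent:
  assumes "descends n x" "cor i x < 0"
  obtains m where "n = Suc m" "descends m (reflect i x)"
proof -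
  have "\<exists>m. n = Suc m \<and> descends m (reflect i x)"
    using assms
  proof (induction n arbitrary: x i rule: less_induct)
    case (less n)
    \<comment> \<open>The induction hypothesis is iterated: each move of a play from a point with a
      shorter descent costs exactly one step.\<close>
    have up: "\<exists>m. k = m + length w \<and> descends m (fold reflect w y)"
      if "k < n" "descends k y" "fires w y" for k w y
      using that
    proof (induction w arbitrary: k y)
      case Nil
      then show ?case by simp
    next
      case (Cons l w)
      then obtain k' where k': "k = Suc k'" "descends k' (reflect l y)"
        using less.IH[of k y l] by auto
      then show ?case
        using Cons.IH[of k' "reflect l y"] Cons.prems by auto
    qed
    from less.prems(1) show ?case
    proof cases
      case start
      then show ?thesis
        using less.prems(2) dominant[of i] by simp
    next
      case (step m y j)
      have y: "reflect j x = y" and "cor j x < 0"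
        using step by auto
      show ?thesis
      proof (cases "i = j")
        case True
        then show ?thesis
          using step y by auto
      next
        case False
        have up_j: "length w \<le> m" "descends (m - length w) (fold reflect (j # w) x)"
          if "fires (j # w) x" for w
          using up[of m y w] that step y by auto
        from fires_dihedral[OF False less.prems(2) \<open>cor j x < 0\<close>] show ?thesis
        proof
          \<comment> \<open>Once \<open>j\<close> has fired only \<open>m\<close> steps are left, so
            a play with \<open>Suc m\<close> further moves is impossible.\<close>
          assume "\<forall>n. \<exists>w. length w = n \<and> fires (j # w) x"
          then obtain w where "length w = Suc m" "fires (j # w) x"
            by blast
          then show ?thesis
            using up_j(1)[of w] by simp
        next
          assume "\<exists>u w. fires (i # u) x \<and> fires (j # w) x \<and> length u = length w
            \<and> fold reflect (i # u) x = fold reflect (j # w) x"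
          then obtain u w where uw: "fires (i # u) x" "fires (j # w) x" "length u = length w"
            "fold reflect (i # u) x = fold reflect (j # w) x"
            by blast
          \<comment> \<open>Both plays have equal length, so going up through \<open>j\<close> and
            back down through \<open>i\<close> leaves \<open>reflect i x\<close> with exactly
            \<open>m\<close> steps.\<close>
          have "descends (m - length w) (fold reflect u (reflect i x))"
            using up_j(2)[OF uw(2)] uw(4) by simp
          then have "descends (m - length w + length u) (reflect i x)"
            using uw(1) by (intro descends_fires) auto
          then show ?thesis
            using up_j(1)[OF uw(2)] uw(3) step by auto
        qed
      qed
    qed
  qed
  then show thesis
    using that by blast
qed

text \<open>The orbit of \<open>\<mu>\<close> under W_I, built from single reflections;
  \<open>generate_orbit\<close> relates it to the group.\<close>

inductive_set orbit :: "'m set \<Rightarrow> 'v set" for I where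
  base: "\<mu> \<in> orbit I"
| reflect: "x \<in> orbit I \<Longrightarrow> i \<in> I \<Longrightarrow> reflect i x \<in> orbit I"

lemma orbit_mono: "I \<subseteq> J \<Longrightarrow> orbit I \<subseteq> orbit J"
proof
  fix x assume "I \<subseteq> J" "x \<in> orbit I"
  from this(2,1) show "x \<in> orbit J"
    by induction (auto intro: orbit.intros)
qed

lemma orbit_descends: "x \<in> orbit I \<Longrightarrow> \<exists>n. descends n x"
proof (induction rule: orbit.induct)
  case base
  then show ?case
    using start by blast
next
  case (reflect x i)
  then obtain n where n: "descends n x"
    by blast
  consider "cor i x > 0" | "cor i x = 0" | "cor i x < 0"
    by linarith
  then show ?case
  proof cases
    case 1
    then show ?thesis
      using n step by blast
  next
    case 2
    then show ?thesis
      using n by (auto simp: reflect_fixed)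
  next
    case 3
    then show ?thesis
      using n ascent by blast
  qed
qed

section \<open>Coordinates and supports of orbit points\<close>

text \<open>Independence of the roots makes \<open>d\<close> unique (\<open>wt_inj\<close>), so its
  support is an invariant of the point.\<close>

definition wt :: "('m \<Rightarrow> real) \<Rightarrow> 'v" where
  "wt d = \<mu> - (\<Sum>i\<in>UNIV. d i *\<^sub>R \<alpha> i)"

abbreviation supp :: "('m \<Rightarrow> real) \<Rightarrow> 'm set" where
  "supp d \<equiv> {i. d i \<noteq> 0}"

lemma wt_0: "wt (\<lambda>_. 0) = \<mu>"
  by (simp add: wt_def)

lemma wt_inj:
  assumes "wt d = wt e"
  shows "d = e"
proof -
  have "(\<Sum>i\<in>UNIV. (d i - e i) *\<^sub>R \<alpha> i) = 0"
    using assms by (simp add: wt_def scaleR_diff_left sum_subtractf)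
  then have "(\<Sum>v\<in>range \<alpha>. (d (inv_into UNIV \<alpha> v) - e (inv_into UNIV \<alpha> v)) *\<^sub>R v) = 0"
    using inj_root by (simp add: sum.reindex)
  then have "d (inv_into UNIV \<alpha> v) - e (inv_into UNIV \<alpha> v) = 0" if "v \<in> range \<alpha>" for v
    using independentD[OF independent_roots, of "range \<alpha>" "\<lambda>v. d (inv_into UNIV \<alpha> v) - e (inv_into UNIV \<alpha> v)" v]
      that by simp
  from this[OF rangeI] show ?thesis
    using inj_root by (simp add: fun_eq_iff)
qed

lemma wt_convex:
  "u + v = 1 \<Longrightarrow> u *\<^sub>R wt d + v *\<^sub>R wt e = wt (\<lambda>i. u * d i + v * e i)"
proof -
  assume "u + v = 1"
  then have "u *\<^sub>R \<mu> + v *\<^sub>R \<mu> = \<mu>"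
    by (simp flip: scaleR_left.add)
  then show ?thesis
    by (simp add: wt_def scaleR_diff_right scaleR_sum_right scaleR_left_distrib sum.distrib algebra_simps)
qed

lemma wt_update: "wt d - c *\<^sub>R \<alpha> i = wt (d(i := d i + c))"
proof -
  have "(\<Sum>j\<in>UNIV. (d(i := d i + c)) j *\<^sub>R \<alpha> j) = (\<Sum>j\<in>UNIV. d j *\<^sub>R \<alpha> j + (if j = i then c *\<^sub>R \<alpha> i else 0))"
    by (intro sum.cong) (auto simp: scaleR_left_distrib)
  then show ?thesis
    by (simp add: wt_def sum.distrib)
qed

lemma reflect_wt: "reflect i (wt d) = wt (d(i := d i + cor i (wt d)))"
  unfolding reflect_def by (rule wt_update)

lemma cor_wt: "cor i (wt d) = cor i \<mu> - (\<Sum>j\<in>UNIV. d j * real_of_int (A $ i $ j))"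
  by (simp add: wt_def cor_simps cor_root)

text \<open>Off-diagonal Cartan entries are nonpositive, so subtracting the other simple roots can
  only raise the i-th coordinate of the dominant \<open>\<mu>\<close>.\<close>

lemma cor_wt_nonneg:
  assumes "\<And>j. d j \<ge> 0" "d i = 0"
  shows "cor i (wt d) \<ge> 0"
proof -
  have "(\<Sum>j\<in>UNIV. d j * real_of_int (A $ i $ j)) \<le> 0"
  proof (rule sum_nonpos)
    fix j show "d j * real_of_int (A $ i $ j) \<le> 0"
      using assms cartan_offdiag[of i j] by (cases "i = j") (auto simp: mult_nonneg_nonpos)
  qed
  then show ?thesis
    using dominant[of i] by (simp add: cor_wt)
qed

text \<open>No nonempty union of connected components of \<open>S\<close> is orthogonal to \<open>\<mu>\<close>.\<close>

definition mu_connected :: "'m set \<Rightarrow> bool" where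
  "mu_connected S \<longleftrightarrow> (\<forall>U\<subseteq>S. U \<noteq> {} \<longrightarrow> (\<forall>i\<in>U. cor i \<mu> = 0) \<longrightarrow> (\<exists>i\<in>U. \<exists>j\<in>S - U. A $ i $ j \<noteq> 0))"

lemma mu_connected_empty: "mu_connected {}"
  by (auto simp: mu_connected_def)

lemma mu_connected_Un:
  assumes "mu_connected S" "mu_connected T"
  shows "mu_connected (S \<union> T)"
  unfolding mu_connected_def
proof (intro allI impI)
  fix U assume U: "U \<subseteq> S \<union> T" "U \<noteq> {}" "\<forall>i\<in>U. cor i \<mu> = 0"
  then consider "U \<inter> S \<noteq> {}" | "U \<inter> T \<noteq> {}"
    by blast
  then show "\<exists>i\<in>U. \<exists>j\<in>S \<union> T - U. A $ i $ j \<noteq> 0"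
  proof cases
    case 1
    then have "\<exists>i\<in>U \<inter> S. \<exists>j\<in>S - U \<inter> S. A $ i $ j \<noteq> 0"
      using assms(1) U(3) unfolding mu_connected_def by (meson IntD1 inf_le2)
    then show ?thesis
      by blast
  next
    case 2
    then have "\<exists>i\<in>U \<inter> T. \<exists>j\<in>T - U \<inter> T. A $ i $ j \<noteq> 0"
      using assms(2) U(3) unfolding mu_connected_def by (meson IntD1 inf_le2)
    then show ?thesis
      by blast
  qed
qed

lemma mu_connected_insert:
  assumes S: "mu_connected S" and i: "cor i \<mu> \<noteq> 0 \<or> (\<exists>j\<in>S. A $ i $ j \<noteq> 0)"
  shows "mu_connected (insert i S)"
proof (cases "i \<in> S")
  case False
  show ?thesis
    unfolding mu_connected_def
  proof (intro allI impI)
    fix U assume U: "U \<subseteq> insert i S" "U \<noteq> {}" "\<forall>i\<in>U. cor i \<mu> = 0"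
    show "\<exists>k\<in>U. \<exists>j\<in>insert i S - U. A $ k $ j \<noteq> 0"
    proof (cases "U - {i} = {}")
      case True
      then have "U = {i}"
        using U by blast
      then show ?thesis
        using U i False by auto
    next
      case nonempty: False
      moreover have "U - {i} \<subseteq> S"
        using U by blast
      ultimately have "\<exists>k\<in>U - {i}. \<exists>j\<in>S - (U - {i}). A $ k $ j \<noteq> 0"
        using S U(3) unfolding mu_connected_def by (meson DiffD1)
      \<comment> \<open>The neighbour found lies in \<open>S\<close>, hence differs from
        \<open>i\<close> and is outside \<open>U\<close>.\<close>
      then show ?thesis
        using False by blast
    qed
  qed
qed (use S in \<open>simp add: insert_absorb\<close>)

text \<open>A positive i-th coordinate has to come from \<open>\<mu>\<close> or from a root of the
  support that pairs nontrivially with \<open>i\<close>, so adding \<open>i\<close> keeps the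
  support \<mu>-connected.\<close>

lemma descends_wt:
  "descends n x \<Longrightarrow> \<exists>d. x = wt d \<and> (\<forall>i. d i \<ge> 0) \<and> mu_connected (supp d)"
proof (induction rule: descends.induct)
  case start
  show ?case
    using mu_connected_empty by (intro exI[of _ "\<lambda>_. 0"]) (simp add: wt_0)
next
  case (step n x i)
  then obtain d where d: "x = wt d" "\<forall>i. d i \<ge> 0" "mu_connected (supp d)"
    by blast
  define e where "e = d(i := d i + cor i x)"
  have "e i > 0"
    using d(2) step.hyps by (simp add: e_def add_nonneg_pos)
  then have supp: "supp e = insert i (supp d)"
    by (auto simp: e_def)
  have "cor i \<mu> \<noteq> 0 \<or> (\<exists>j\<in>supp d. A $ i $ j \<noteq> 0)"
  proof (rule ccontr)
    assume "\<not> ?thesis"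
    then have "cor i x = 0"
      using d(1) by (auto simp: cor_wt intro!: sum.neutral)
    then show False
      using step.hyps by simp
  qed
  then have "mu_connected (supp e)"
    unfolding supp by (rule mu_connected_insert[OF d(3)])
  moreover have "\<forall>j. e j \<ge> 0"
    using d(2) step.hyps by (simp add: e_def)
  moreover have "reflect i x = wt e"
    using d(1) by (simp add: e_def reflect_wt)
  ultimately show ?case
    by blast
qed

lemma descends_nonneg: "descends n (wt d) \<Longrightarrow> d i \<ge> 0"
  using descends_wt wt_inj by blast

lemma orbit_supp: "x \<in> orbit I \<Longrightarrow> \<exists>d. x = wt d \<and> supp d \<subseteq> I"
proof (induction rule: orbit.induct)
  case base
  show ?case
    by (intro exI[of _ "\<lambda>_. 0"]) (simp add: wt_0)
next
  case (reflect x i)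
  then obtain d where "x = wt d" "supp d \<subseteq> I"
    by blast
  then have "reflect i x = wt (d(i := d i + cor i x))" "supp (d(i := d i + cor i x)) \<subseteq> I"
    using reflect.hyps by (auto simp only: reflect_wt fun_upd_apply split: if_splits)
  then show ?case
    by blast
qed

text \<open>Climbing at nodes of \<open>I\<close> keeps the support in \<open>I\<close>. When no
  negative node of \<open>I\<close> is left, the nodes outside \<open>I\<close> are nonnegative by
  \<open>cor_wt_nonneg\<close>. A point without negative coordinates is not the result of a
  descending step, so it is \<open>\<mu>\<close>.\<close>

lemma descends_in_orbit:
  assumes "descends n (wt d)" "supp d \<subseteq> I"
  shows "wt d \<in> orbit I"
  using assms
proof (induction n arbitrary: d rule: less_induct)
  case (less n)
  show ?case
  proof (cases "\<exists>i\<in>I. cor i (wt d) < 0")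
    case True
    then obtain i m where i: "i \<in> I" "n = Suc m" "descends m (reflect i (wt d))"
      using ascent less.prems(1) by blast
    define e where "e = d(i := d i + cor i (wt d))"
    have e: "reflect i (wt d) = wt e"
      by (simp add: e_def reflect_wt)
    have "wt e \<in> orbit I"
    proof (rule less.IH)
      show "m < n" "descends m (wt e)"
        using i e by simp_all
      show "supp e \<subseteq> I"
        using i less.prems(2) by (auto simp: e_def)
    qed
    then have "reflect i (wt e) \<in> orbit I"
      using i orbit.reflect by blast
    then show ?thesis
      by (simp flip: e)
  next
    case False
    have "cor i (wt d) \<ge> 0" for i
      using False less.prems descends_nonneg cor_wt_nonneg[of d i] by (cases "i \<in> I") force+
    with less.prems(1) have "wt d = \<mu>"
    proof cases
      case (step m y j)
      have "cor j (wt d) < 0"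
        unfolding step(2) using step(4) by simp
      then show ?thesis
        using \<open>\<And>i. cor i (wt d) \<ge> 0\<close> by (simp add: leD)
    qed
    then show ?thesis
      using orbit.base by simp
  qed
qed

section \<open>Faces of the hull of the orbit\<close>

definition hull_orbit :: "'m set \<Rightarrow> 'v set" where
  "hull_orbit I = convex hull (orbit I)"

lemma convex_hull_orbit: "convex (hull_orbit I)"
  by (simp add: hull_orbit_def)

lemma orbit_subset_hull: "orbit I \<subseteq> hull_orbit I"
  by (simp add: hull_orbit_def hull_subset)

lemma mu_in_hull: "\<mu> \<in> hull_orbit I"
  using orbit.base orbit_subset_hull by blast

lemma hull_orbit_mono: "I \<subseteq> J \<Longrightarrow> hull_orbit I \<subseteq> hull_orbit J"
  unfolding hull_orbit_def by (intro hull_mono orbit_mono)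

text \<open>The points of the hull with property \<open>P\<close> form a convex set containing the
  orbit. The rule works along open segments, the shape in which faces are defined.\<close>

lemma orbit_induct_hull [consumes 1, case_names orbit segment]:
  assumes x: "x \<in> hull_orbit I"
    and orbit: "\<And>x. x \<in> orbit I \<Longrightarrow> P x"
    and segment: "\<And>a b x. a \<in> hull_orbit I \<Longrightarrow> b \<in> hull_orbit I \<Longrightarrow> P a \<Longrightarrow> P b \<Longrightarrow>
      x \<in> open_segment a b \<Longrightarrow> P x"
  shows "P x"
proof -
  have "convex {x \<in> hull_orbit I. P x}"
    unfolding convex_contains_open_segment
  proof (intro ballI subsetI)
    fix a b x
    assume "a \<in> {x \<in> hull_orbit I. P x}" "b \<in> {x \<in> hull_orbit I. P x}" "x \<in> open_segment a b"
    then show "x \<in> {x \<in> hull_orbit I. P x}"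
      using segment[of a b x] convex_hull_orbit[of I] convex_contains_open_segment by blast
  qed
  then have "hull_orbit I \<subseteq> {x \<in> hull_orbit I. P x}"
    using orbit orbit_subset_hull unfolding hull_orbit_def by (intro hull_minimal) auto
  then show ?thesis
    using x by blast
qed

lemma reflect_hull_orbit: "x \<in> hull_orbit I \<Longrightarrow> i \<in> I \<Longrightarrow> reflect i x \<in> hull_orbit I"
proof -
  assume "x \<in> hull_orbit I" "i \<in> I"
  then have "reflect i x \<in> convex hull (reflect i ` orbit I)"
    unfolding hull_orbit_def convex_hull_linear_image[OF linear_reflect, symmetric] by blast
  moreover have "reflect i ` orbit I \<subseteq> orbit I"
    using \<open>i \<in> I\<close> orbit.reflect by blast
  ultimately show ?thesis
    unfolding hull_orbit_def using hull_mono by blast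
qed

lemma open_segment_wt:
  assumes "x \<in> open_segment (wt d) (wt e)"
  obtains u where "0 < u" "u < 1" "x = wt (\<lambda>i. (1 - u) * d i + u * e i)"
  using assms unfolding in_segment by (auto simp: wt_convex)

text \<open>Nonnegativity excludes cancellation.\<close>

lemma supp_combination:
  assumes "0 < u" "u < 1" "\<And>i. d i \<ge> 0" "\<And>i. e i \<ge> 0"
  shows "supp (\<lambda>i. (1 - u) * d i + u * e i) = supp d \<union> supp e"
proof (rule subset_antisym)
  show "supp d \<union> supp e \<subseteq> supp (\<lambda>i. (1 - u) * d i + u * e i)"
  proof
    fix i assume "i \<in> supp d \<union> supp e"
    then have "d i > 0 \<or> e i > 0"
      using assms(3,4)[of i] by auto
    then have "(1 - u) * d i + u * e i > 0"
      using assms(1,2) assms(3,4)[of i] by (auto intro: add_pos_nonneg add_nonneg_pos)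
    then show "i \<in> supp (\<lambda>i. (1 - u) * d i + u * e i)"
      by simp
  qed
qed auto

lemma hull_orbit_wt:
  assumes "x \<in> hull_orbit I"
  shows "\<exists>d. x = wt d \<and> (\<forall>i. d i \<ge> 0) \<and> supp d \<subseteq> I \<and> mu_connected (supp d)"
  using assms
proof (induction rule: orbit_induct_hull)
  case (orbit x)
  then obtain n where "descends n x"
    using orbit_descends by blast
  from orbit obtain d where d: "x = wt d" "supp d \<subseteq> I"
    using orbit_supp by blast
  from descends_wt[OF \<open>descends n x\<close>] obtain e
    where e: "x = wt e" "\<forall>i. e i \<ge> 0" "mu_connected (supp e)"
    by blast
  have "d = e"
    using d e by (intro wt_inj) simp
  then show ?case
    using d e by blast
next
  case (segment a b x)
  then obtain d e where d: "a = wt d" "\<forall>i. d i \<ge> 0" "supp d \<subseteq> I" "mu_connected (supp d)"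
    and e: "b = wt e" "\<forall>i. e i \<ge> 0" "supp e \<subseteq> I" "mu_connected (supp e)"
    by blast
  then obtain u where u: "0 < u" "u < 1" "x = wt (\<lambda>i. (1 - u) * d i + u * e i)"
    using open_segment_wt segment.hyps(3) by blast
  have "supp (\<lambda>i. (1 - u) * d i + u * e i) = supp d \<union> supp e"
    using u d(2) e(2) by (intro supp_combination) auto
  moreover have "\<forall>i. (1 - u) * d i + u * e i \<ge> 0"
    using u d(2) e(2) by simp
  ultimately show ?case
    using u(3) d e mu_connected_Un[of "supp d" "supp e"]
    by (intro exI[of _ "\<lambda>i. (1 - u) * d i + u * e i"]) simp
qed

lemma hull_orbit_nonneg: "wt d \<in> hull_orbit I \<Longrightarrow> d i \<ge> 0"
  using hull_orbit_wt wt_inj by blast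

lemma hull_orbit_supp: "wt d \<in> hull_orbit I \<Longrightarrow> supp d \<subseteq> I"
  using hull_orbit_wt wt_inj by blast

lemma hull_orbit_mu_connected: "wt d \<in> hull_orbit I \<Longrightarrow> mu_connected (supp d)"
  using hull_orbit_wt wt_inj by blast

text \<open>Supports cannot cancel along a segment, so its endpoints inherit the support bound; at
  orbit points \<open>descends_in_orbit\<close> applies.\<close>

lemma hull_orbit_restrict:
  assumes "x \<in> hull_orbit J" "x = wt d" "supp d \<subseteq> I"
  shows "x \<in> hull_orbit I"
  using assms
proof (induction arbitrary: d rule: orbit_induct_hull)
  case (orbit x)
  then show ?case
    using orbit_descends descends_in_orbit orbit_subset_hull by blast
next
  case (segment a b x)
  obtain f g where f: "a = wt f" "\<forall>i. f i \<ge> 0" and g: "b = wt g" "\<forall>i. g i \<ge> 0"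
    using segment.hyps(1,2) hull_orbit_wt by metis
  then obtain u where u: "0 < u" "u < 1" "x = wt (\<lambda>i. (1 - u) * f i + u * g i)"
    using open_segment_wt segment.hyps(3) by blast
  then have "supp f \<union> supp g = supp d"
    using supp_combination[of u f g] f g segment.prems(1) wt_inj by blast
  then have "a \<in> hull_orbit I" "b \<in> hull_orbit I"
    using segment.IH(1)[OF f(1)] segment.IH(2)[OF g(1)] segment.prems(2) by auto
  then show ?case
    using segment.hyps(3) convex_hull_orbit convex_contains_open_segment by blast
qed

text \<open>Vanishing of nonnegative coefficients outside \<open>I\<close> passes from an interior
  point of a segment to its endpoints.\<close>

lemma hull_orbit_face: "hull_orbit I face_of hull_orbit UNIV"
  unfolding face_of_def
proof (intro conjI ballI impI)
  show "hull_orbit I \<subseteq> hull_orbit UNIV"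
    by (simp add: hull_orbit_mono)
  show "convex (hull_orbit I)"
    by (rule convex_hull_orbit)
next
  fix a b x
  assume ab: "a \<in> hull_orbit UNIV" "b \<in> hull_orbit UNIV"
    and x: "x \<in> hull_orbit I" "x \<in> open_segment a b"
  obtain f g where f: "a = wt f" "\<forall>i. f i \<ge> 0" and g: "b = wt g" "\<forall>i. g i \<ge> 0"
    using ab hull_orbit_wt by metis
  then obtain u where u: "0 < u" "u < 1" "x = wt (\<lambda>i. (1 - u) * f i + u * g i)"
    using open_segment_wt x(2) by blast
  have "supp f \<union> supp g = supp (\<lambda>i. (1 - u) * f i + u * g i)"
    using u f(2) g(2) by (intro supp_combination[symmetric]) auto
  also have "\<dots> \<subseteq> I"
    using x(1) unfolding u(3) by (rule hull_orbit_supp)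
  finally have "supp f \<union> supp g \<subseteq> I" .
  then show "a \<in> hull_orbit I" "b \<in> hull_orbit I"
    using hull_orbit_restrict ab f g by auto
qed

section \<open>Dominant points and the smallest faces containing them\<close>

text \<open>Among the dominant points of the hull one of maximal support is taken. If it missed part
  of \<open>I\<close>, it could be moved to gain a node without losing dominance.\<close>

lemma exists_dominant_full_support:
  assumes "mu_connected I"
  shows "\<exists>d. supp d = I \<and> wt d \<in> hull_orbit I \<and> (\<forall>i. cor i (wt d) \<ge> 0)"
proof -
  define D where "D = {d. wt d \<in> hull_orbit I \<and> (\<forall>i. cor i (wt d) \<ge> 0)}"
  have "(\<lambda>_. 0) \<in> D"
    using mu_in_hull dominant by (simp add: D_def wt_0)
  then have "supp ` D \<noteq> {}"
    by blast
  then obtain S where S: "S \<in> supp ` D" and max: "\<And>T. T \<in> supp ` D \<Longrightarrow> S \<subseteq> T \<Longrightarrow> S = T"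
    using finite_has_maximal[of "supp ` D"] by (metis finite)
  then obtain d where d: "supp d = S" "wt d \<in> hull_orbit I" "\<And>i. cor i (wt d) \<ge> 0"
    by (auto simp: D_def)
  have d_nonneg: "d i \<ge> 0" for i
    using d(2) hull_orbit_nonneg by blast
  have "S \<subseteq> I"
    using d hull_orbit_supp by blast
  moreover have "I - S = {}"
  proof (rule ccontr)
    assume "I - S \<noteq> {}"
    \<comment> \<open>Otherwise sums of nonnegative terms vanish termwise, so \<open>I - S\<close>
      is orthogonal to \<open>\<mu>\<close> and has no edge to \<open>S\<close>, against
      \<mu>-connectedness.\<close>
    have "\<exists>i\<in>I - S. cor i (wt d) \<noteq> 0"
    proof (rule ccontr)
      assume "\<not> ?thesis"
      then have zero: "cor i (wt d) = 0" if "i \<in> I - S" for i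
        using that by blast
      have terms: "cor i \<mu> = 0 \<and> (\<forall>j\<in>UNIV. - (d j * real_of_int (A $ i $ j)) = 0)" if i: "i \<in> I - S" for i
      proof -
        have di: "d i = 0"
          using i d(1) by blast
        have nonneg: "- (d j * real_of_int (A $ i $ j)) \<ge> 0" for j
          using di d_nonneg[of j] cartan_offdiag[of i j]
          by (cases "i = j") (auto simp: mult_nonneg_nonpos)
        have "cor i \<mu> + (\<Sum>j\<in>UNIV. - (d j * real_of_int (A $ i $ j))) = 0"
          using zero[OF i] by (simp add: cor_wt sum_negf)
        moreover have "(\<Sum>j\<in>UNIV. - (d j * real_of_int (A $ i $ j))) \<ge> 0"
          by (rule sum_nonneg) (rule nonneg)
        ultimately have "cor i \<mu> = 0" "(\<Sum>j\<in>UNIV. - (d j * real_of_int (A $ i $ j))) = 0"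
          using dominant[of i] by linarith+
        then show ?thesis
          using nonneg by (subst (asm) sum_nonneg_eq_0_iff) auto
      qed
      obtain i j where ij: "i \<in> I - S" "j \<in> I - (I - S)" "A $ i $ j \<noteq> 0"
        using assms \<open>I - S \<noteq> {}\<close> terms unfolding mu_connected_def by (meson Diff_subset)
      then have "d j \<noteq> 0"
        using d(1) by blast
      then show False
        using terms[OF ij(1)] ij(3) by auto
    qed
    then obtain i where i: "i \<in> I - S" "cor i (wt d) > 0"
      using d(3) by (metis less_eq_real_def)
    \<comment> \<open>Half of the reflection step ends at the midpoint of \<open>wt d\<close> and
      its image: the i-th coordinate becomes 0 and no other one decreases.\<close>
    define c where "c = cor i (wt d) / 2"
    have c: "c > 0"
      using i by (simp add: c_def)
    define e where "e = d(i := d i + c)"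
    have e: "wt e = wt d - c *\<^sub>R \<alpha> i"
      by (simp only: e_def wt_update)
    have "wt e = (1/2) *\<^sub>R wt d + (1/2) *\<^sub>R reflect i (wt d)"
      unfolding e by (simp add: reflect_def c_def algebra_simps flip: scaleR_add_left)
    then have "wt e \<in> hull_orbit I"
      using reflect_hull_orbit[OF d(2), of i] i d(2) by (auto intro!: convexD[OF convex_hull_orbit])
    moreover have "cor j (wt e) \<ge> 0" for j
    proof (cases "j = i")
      case True
      then show ?thesis
        by (simp add: e cor_simps cor_root c_def)
    next
      case False
      then have "c * real_of_int (A $ j $ i) \<le> 0"
        using c cartan_offdiag[of j i] by (simp add: mult_nonneg_nonpos)
      then show ?thesis
        using d(3)[of j] by (simp add: e cor_simps cor_root)
    qed
    ultimately have "e \<in> D"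
      by (simp add: D_def)
    moreover have "e i > 0"
      using c d_nonneg[of i] by (simp add: e_def)
    then have "supp e = insert i S"
      using d(1) by (auto simp: e_def)
    ultimately have "S = insert i S"
      using max by blast
    then show False
      using i by blast
  qed
  ultimately show ?thesis
    using d by blast
qed

text \<open>The smallest face containing \<open>wt d\<close> is closed under the reflections of \<open>I\<close>: wherever
  reflecting moves a point, the segment it spans is balanced against a segment in the
  same direction through a point of the face.\<close>

lemma face_of_full_support:
  assumes d: "supp d = I" "wt d \<in> hull_orbit I" "\<And>i. cor i (wt d) \<ge> 0"
    and T: "T face_of hull_orbit I" "wt d \<in> T"
  shows "hull_orbit I \<subseteq> T"
proof -
  define G where "G = \<Inter>{T. T face_of hull_orbit I \<and> wt d \<in> T}"
  have G: "G face_of hull_orbit I" "wt d \<in> G"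
    unfolding G_def using T by (auto intro!: face_of_Inter)
  have G_sub: "G \<subseteq> hull_orbit I"
    using G face_of_imp_subset by blast
  have up: "reflect i x \<in> G" if i: "i \<in> I" and x: "x \<in> G" "cor i x < 0" for i x
  proof (cases "cor i (wt d) = 0")
    case True
    \<comment> \<open>\<open>reflect i\<close> fixes \<open>wt d\<close>, so it permutes the faces
      through \<open>wt d\<close> and preserves their intersection \<open>G\<close>.\<close>
    have "reflect i x \<in> T" if T: "T face_of hull_orbit I" "wt d \<in> T" for T
    proof -
      have "reflect i ` hull_orbit I = hull_orbit I"
        using reflect_hull_orbit[OF _ i] by (metis image_subset_iff reflect_reflect subset_antisym subsetI image_eqI)
      then have "reflect i ` T face_of hull_orbit I"
        using face_of_linear_image[OF linear_reflect inj_reflect] T(1) by metis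
      moreover have "wt d \<in> reflect i ` T"
        using T(2) reflect_fixed[OF True] by (metis image_eqI)
      ultimately have "x \<in> reflect i ` T"
        using x(1) by (auto simp: G_def)
      then show ?thesis
        by auto
    qed
    then show ?thesis
      by (auto simp: G_def)
  next
    case False
    then have pos: "cor i (wt d) > 0"
      using d(3)[of i] by simp
    \<comment> \<open>With these weights the displacements along \<open>\<alpha> i\<close> cancel,
      so the two reflected points have the same weighted mean \<open>z\<close> as \<open>x\<close>
      and \<open>wt d\<close>.\<close>
    let ?s = "cor i (wt d)" and ?t = "- cor i x"
    obtain z where z: "z \<in> G" "?s *\<^sub>R x + ?t *\<^sub>R wt d = (?s + ?t) *\<^sub>R z"
      using convex_weightedE[OF face_of_imp_convex[OF G(1)] x(1) G(2), of ?s ?t] pos x(2) by auto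
    then have eq: "?s *\<^sub>R reflect i x + ?t *\<^sub>R reflect i (wt d) = (?s + ?t) *\<^sub>R z"
      by (simp add: reflect_def algebra_simps)
    have hull: "reflect i x \<in> hull_orbit I" "reflect i (wt d) \<in> hull_orbit I"
      using G_sub x(1) d(2) i reflect_hull_orbit by auto
    show ?thesis
      using face_of_weightedD[OF G(1) hull z(1) pos _ eq] x(2) by simp
  qed
  \<comment> \<open>The climb to \<open>\<mu>\<close> fires every node of the support of
    \<open>e\<close>; the position just before such a firing is the required
    \<open>y\<close>.\<close>
  have ascend: "\<mu> \<in> G \<and> (\<forall>i. e i \<noteq> 0 \<longrightarrow> (\<exists>y\<in>G. cor i y < 0))"
    if "descends n (wt e)" "wt e \<in> G" for n e
    using that
  proof (induction n arbitrary: e)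
    case 0
    then have "wt e = \<mu>"
      by (auto elim: descends.cases)
    then have "e = (\<lambda>_. 0)"
      using wt_0 wt_inj by metis
    then show ?case
      using 0 \<open>wt e = \<mu>\<close> by simp
  next
    case (Suc n)
    from Suc.prems(1) obtain y j where y: "wt e = reflect j y" "descends n y" "cor j y > 0"
      by (auto elim: descends.cases)
    obtain f where f: "y = wt f" "\<forall>i. f i \<ge> 0"
      using descends_wt y(2) by blast
    have e: "e = f(j := f j + cor j y)"
      using y(1) wt_inj unfolding f(1) reflect_wt by blast
    have "e j > 0"
      using f(2) y(3) by (simp add: e add_nonneg_pos)
    then have "j \<in> I"
      using Suc.prems(2) G_sub hull_orbit_supp[of e I] by force
    have neg: "cor j (wt e) < 0"
      using y by simp
    have "wt f = reflect j (wt e)"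
      using y(1) f(1) by simp
    then have "wt f \<in> G"
      using up[OF \<open>j \<in> I\<close> Suc.prems(2) neg] by simp
    then have "\<mu> \<in> G \<and> (\<forall>i. f i \<noteq> 0 \<longrightarrow> (\<exists>y\<in>G. cor i y < 0))"
      using Suc.IH y(2) f(1) by blast
    moreover have "e i = f i" if "i \<noteq> j" for i
      using that by (simp add: e)
    ultimately show ?case
      using neg Suc.prems(2) by metis
  qed
  \<comment> \<open>\<open>wt d\<close> is a convex combination of orbit points, which lie in the
    face \<open>G\<close>; their supports must cover \<open>I\<close>.\<close>
  have vertex: "\<exists>e n. wt e \<in> G \<and> descends n (wt e) \<and> e i \<noteq> 0" if i: "i \<in> I" for i
  proof -
    have "\<exists>e n. wt e \<in> G \<and> descends n (wt e) \<and> e i \<noteq> 0"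
      if "x \<in> hull_orbit I" "x \<in> G" "x = wt f" "f i \<noteq> 0" for x f
      using that
    proof (induction arbitrary: f rule: orbit_induct_hull)
      case (orbit x)
      then show ?case
        using orbit_descends by blast
    next
      case (segment a b x)
      obtain g h where g: "a = wt g" and h: "b = wt h"
        using segment.hyps(1,2) hull_orbit_wt by metis
      then obtain u where "x = wt (\<lambda>i. (1 - u) * g i + u * h i)"
        using open_segment_wt segment.hyps(3) by blast
      then have "f i = (1 - u) * g i + u * h i"
        using segment.prems(2) wt_inj by blast
      then have "g i \<noteq> 0 \<or> h i \<noteq> 0"
        using segment.prems(3) by auto
      moreover have "a \<in> G" "b \<in> G"
        using face_ofD[OF G(1) segment.hyps(3)] segment by auto
      ultimately show ?case
        using segment.IH(1)[OF _ g] segment.IH(2)[OF _ h] by blast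
    qed
    then show ?thesis
      using d G(2) i by blast
  qed
  have closed: "reflect i x \<in> G" if i: "i \<in> I" and x: "x \<in> G" for i x
  proof -
    obtain y where y: "y \<in> G" "cor i y < 0"
      using vertex[OF i] ascend by blast
    consider "cor i x > 0" | "cor i x = 0" | "cor i x < 0"
      by linarith
    then show ?thesis
    proof cases
      case 1
      \<comment> \<open>The same balancing as in \<open>up\<close>, now with \<open>y\<close> as the
        counterweight of negative coordinate.\<close>
      let ?s = "- cor i y" and ?t = "cor i x"
      obtain z where z: "z \<in> G" "?s *\<^sub>R x + ?t *\<^sub>R y = (?s + ?t) *\<^sub>R z"
        using convex_weightedE[OF face_of_imp_convex[OF G(1)] x y(1), of ?s ?t] 1 y(2) by auto
      then have eq: "?s *\<^sub>R reflect i x + ?t *\<^sub>R reflect i y = (?s + ?t) *\<^sub>R z"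
        by (simp add: reflect_def algebra_simps)
      have hull: "reflect i x \<in> hull_orbit I" "reflect i y \<in> hull_orbit I"
        using G_sub x y(1) i reflect_hull_orbit by auto
      show ?thesis
        using face_of_weightedD[OF G(1) hull z(1) _ 1 eq] y(2) by simp
    qed (use x up[OF i] in \<open>auto simp: reflect_fixed\<close>)
  qed
  have "\<mu> \<in> G"
  proof (cases "I = {}")
    case True
    then have "d = (\<lambda>_. 0)"
      using d(1) by auto
    then show ?thesis
      using G(2) by (simp add: wt_0)
  next
    case False
    then show ?thesis
      using vertex ascend by blast
  qed
  have "x \<in> orbit I \<Longrightarrow> x \<in> G" for x
    by (induction rule: orbit.induct) (use \<open>\<mu> \<in> G\<close> closed in auto)
  then have "hull_orbit I \<subseteq> G"
    unfolding hull_orbit_def using face_of_imp_convex[OF G(1)] by (intro hull_minimal) auto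
  also have "G \<subseteq> T"
    using T by (auto simp: G_def)
  finally show ?thesis .
qed

text \<open>A point of full support in \<open>hull_orbit I\<close> recovers
  \<open>I\<close>.\<close>

lemma hull_orbit_le_iff:
  assumes "mu_connected I"
  shows "hull_orbit I \<subseteq> hull_orbit J \<longleftrightarrow> I \<subseteq> J"
proof
  obtain d where d: "supp d = I" "wt d \<in> hull_orbit I"
    using exists_dominant_full_support[OF assms] by blast
  assume "hull_orbit I \<subseteq> hull_orbit J"
  with d show "I \<subseteq> J"
    using hull_orbit_supp[of d J] by blast
qed (rule hull_orbit_mono)

text \<open>The support of \<open>\<mu> - x\<close> is the required \<open>I\<close>: minimality
  gives one inclusion and \<open>face_of_full_support\<close> the other. The premise
  \<open>min\<close> is how a relative interior point enters.\<close>

lemma minimal_face_at_dominant: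
  assumes F: "F face_of hull_orbit UNIV" "x \<in> F" "\<And>i. cor i x \<ge> 0"
    and min: "\<And>T. T face_of hull_orbit UNIV \<Longrightarrow> x \<in> T \<Longrightarrow> F \<subseteq> T"
  shows "\<exists>I. mu_connected I \<and> F = hull_orbit I"
proof -
  have H: "x \<in> hull_orbit UNIV"
    using face_of_imp_subset[OF F(1)] F(2) by blast
  then obtain d where d: "x = wt d"
    using hull_orbit_wt[OF H] by blast
  have x: "wt d \<in> hull_orbit (supp d)"
    using hull_orbit_restrict[OF H d order_refl] by (simp add: d)
  have sub: "F \<subseteq> hull_orbit (supp d)"
    by (rule min) (use x in \<open>simp_all add: hull_orbit_face d\<close>)
  have "F face_of hull_orbit (supp d)"
    by (intro face_of_subset[OF F(1) sub] hull_orbit_mono subset_UNIV)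
  then have "hull_orbit (supp d) \<subseteq> F"
    by (intro face_of_full_support[OF HOL.refl x]) (use F(2,3) d in simp_all)
  with sub have "F = hull_orbit (supp d)"
    by (rule subset_antisym)
  then show ?thesis
    using hull_orbit_mu_connected[OF x] by blast
qed

section \<open>The orbit under the generated group\<close>

lemma reflect_in_general_linear: "reflect i \<in> carrier general_linear_group"
  by (simp add: general_linear_group_def linear_reflect bij_reflect)

lemma inv_reflect: "m_inv general_linear_group (reflect i) = reflect i"
  unfolding m_inv_def
proof (rule the_equality)
  have "reflect i \<circ> reflect i = id"
    by auto
  then show "reflect i \<in> carrier general_linear_group \<and>
      reflect i \<otimes>\<^bsub>general_linear_group\<^esub> reflect i = \<one>\<^bsub>general_linear_group\<^esub> \<and>
      reflect i \<otimes>\<^bsub>general_linear_group\<^esub> reflect i = \<one>\<^bsub>general_linear_group\<^esub>"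
    using reflect_in_general_linear by (simp add: general_linear_group_def)
next
  fix g assume "g \<in> carrier general_linear_group \<and>
      reflect i \<otimes>\<^bsub>general_linear_group\<^esub> g = \<one>\<^bsub>general_linear_group\<^esub> \<and>
      g \<otimes>\<^bsub>general_linear_group\<^esub> reflect i = \<one>\<^bsub>general_linear_group\<^esub>"
  then have "g (reflect i x) = x" for x
    by (simp add: general_linear_group_def fun_eq_iff)
  from this[of "reflect i _"] show "g = reflect i"
    by auto
qed

lemma generate_orbit:
  "(\<lambda>w. w \<mu>) ` generate general_linear_group (reflect ` I) = orbit I"
proof (rule subset_antisym)
  have "\<forall>x\<in>orbit I. w x \<in> orbit I" if "w \<in> generate general_linear_group (reflect ` I)" for w
    using that
  proof induction
    case one
    show ?case
      by (simp add: general_linear_group_def)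
  next
    case (incl h)
    then show ?case
      using orbit.reflect by blast
  next
    case (inv h)
    then obtain i where "i \<in> I" "m_inv general_linear_group h = reflect i"
      using inv_reflect by blast
    then show ?case
      by (simp add: orbit.reflect)
  next
    case (eng g h)
    then show ?case
      by (simp add: general_linear_group_def)
  qed
  then show "(\<lambda>w. w \<mu>) ` generate general_linear_group (reflect ` I) \<subseteq> orbit I"
    using orbit.base by blast
next
  have "\<exists>w\<in>generate general_linear_group (reflect ` I). x = w \<mu>" if "x \<in> orbit I" for x
    using that
  proof induction
    case base
    have "id \<in> generate general_linear_group (reflect ` I)"
      using generate.one[of general_linear_group] by (simp add: general_linear_group_def)
    then show ?case
      by (metis id_apply)
  next
    case (reflect x i)
    then obtain w where w: "w \<in> generate general_linear_group (reflect ` I)" "x = w \<mu>"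
      by blast
    have "reflect i \<otimes>\<^bsub>general_linear_group\<^esub> w \<in> generate general_linear_group (reflect ` I)"
      by (rule generate.eng[OF generate.incl w(1)]) (simp add: reflect.hyps)
    then show ?case
      using w(2) by (intro bexI[of _ "reflect i \<circ> w"]) (simp_all add: general_linear_group_def)
  qed
  then show "orbit I \<subseteq> (\<lambda>w. w \<mu>) ` generate general_linear_group (reflect ` I)"
    by blast
qed

end

section \<open>The isomorphism\<close>

theorem corollary3p14:
  fixes A :: "int^'m^'m"
    and \<alpha> :: "'m \<Rightarrow> ('h::euclidean_space \<Rightarrow>\<^sub>L real)"
    and \<alpha>v :: "'m \<Rightarrow> 'h"
    and \<mu> :: "'h \<Rightarrow>\<^sub>L real"
  assumes "gen_cartan_matrix A"
    and "realization A \<alpha> \<alpha>v"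
    and "\<mu> \<in> fundamental_chamber \<alpha> \<alpha>v"
  shows "poset_isomorphism
           (\<lambda>I. orbit_hull (parabolic_subgroup \<alpha> \<alpha>v I) \<mu>)
           {I. weight_connected \<alpha> \<alpha>v \<mu> I}
           (fundamental_faces \<alpha> \<alpha>v (orbit_hull (weyl_group \<alpha> \<alpha>v) \<mu>) - {{}})"
proof -
  have inj: "inj \<alpha>"
    using assms(2) by (simp add: realization_def)
  then have coroot [simp]: "coroot \<alpha> \<alpha>v (\<alpha> i) = \<alpha>v i" for i
    by (simp add: coroot_def the_inv_f_f)
  interpret dominant_weight A \<alpha> "\<lambda>i \<eta>. blinfun_apply \<eta> (\<alpha>v i)" \<mu>
  proof
    show "0 \<le> blinfun_apply \<mu> (\<alpha>v i)" for i
      using assms(3) by (auto simp: fundamental_chamber_def)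
  qed (use assms(1,2) in \<open>simp_all add: realization_def linearI blinfun.add_left blinfun.scaleR_left\<close>)

  have "simple_reflection \<alpha> \<alpha>v (\<alpha> i) = reflect i" for i
    by (simp add: simple_reflection_def reflect_def fun_eq_iff)
  then have "simple_reflection \<alpha> \<alpha>v ` \<alpha> ` I = reflect ` I" for I
    by (simp add: image_image)
  then have hull: "orbit_hull (parabolic_subgroup \<alpha> \<alpha>v (\<alpha> ` I)) \<mu> = hull_orbit I" for I
    by (simp add: orbit_hull_def parabolic_subgroup_def generate_orbit hull_orbit_def)
  then have hull_UNIV: "orbit_hull (weyl_group \<alpha> \<alpha>v) \<mu> = hull_orbit UNIV"
    by (simp add: weyl_group_def)

  \<comment> \<open>The pairing in \<open>dynkin_edges\<close> is \<open>A $ j $ i\<close>; the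
    symmetry of zero entries allows the indices to be swapped.\<close>
  have edge: "(\<alpha> i, \<alpha> j) \<in> dynkin_edges \<alpha> \<alpha>v \<longleftrightarrow> i \<noteq> j \<and> A $ i $ j \<noteq> 0" for i j
    using inj cartan_zero_sym[of i j] cartan_zero_sym[of j i]
    by (auto simp: dynkin_edges_def cor_root inj_eq)
  have orth: "\<alpha> i \<in> orthogonal_simple_roots \<alpha> \<alpha>v \<mu> \<longleftrightarrow> blinfun_apply \<mu> (\<alpha>v i) = 0" for i
    by (simp add: orthogonal_simple_roots_def)
  have connected: "weight_connected \<alpha> \<alpha>v \<mu> (\<alpha> ` I) \<longleftrightarrow> mu_connected I" for I
  proof
    assume I: "weight_connected \<alpha> \<alpha>v \<mu> (\<alpha> ` I)"
    show "mu_connected I"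
      unfolding mu_connected_def
    proof (intro allI impI, rule ccontr)
      fix U
      assume U: "U \<subseteq> I" "U \<noteq> {}" "\<forall>i\<in>U. blinfun_apply \<mu> (\<alpha>v i) = 0"
        and isolated: "\<not> (\<exists>i\<in>U. \<exists>j\<in>I - U. A $ i $ j \<noteq> 0)"
      then obtain i where i: "i \<in> U"
        by blast
      \<comment> \<open>No edge inside \<open>I\<close> leaves \<open>U\<close>, so the component of
        \<open>\<alpha> i\<close> stays among the roots of \<open>U\<close>, on whose coroots
        \<open>\<mu>\<close> vanishes.\<close>
      have component: "\<beta> \<in> \<alpha> ` U" if "(\<alpha> i, \<beta>) \<in> (dynkin_edges \<alpha> \<alpha>v \<inter> (\<alpha> ` I) \<times> (\<alpha> ` I))\<^sup>*" for \<beta>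
        using that
      proof induction
        case base
        then show ?case
          using i by blast
      next
        case (step \<beta> \<gamma>)
        then obtain k j where kj: "\<beta> = \<alpha> k" "k \<in> U" "\<gamma> = \<alpha> j" "j \<in> I"
          by blast
        have "A $ k $ j \<noteq> 0"
          using step.hyps(2) edge[of k j] unfolding kj by simp
        then have "j \<in> U"
          using isolated kj(2,4) by blast
        then show ?case
          unfolding kj(3) by (rule imageI)
      qed
      have "\<alpha> ` U \<subseteq> orthogonal_simple_roots \<alpha> \<alpha>v \<mu>"
        using U(3) orth by (simp add: image_subset_iff)
      with component have "(dynkin_edges \<alpha> \<alpha>v \<inter> (\<alpha> ` I) \<times> (\<alpha> ` I))\<^sup>* `` {\<alpha> i} \<subseteq> orthogonal_simple_roots \<alpha> \<alpha>v \<mu>"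
        by blast
      moreover have "(dynkin_edges \<alpha> \<alpha>v \<inter> (\<alpha> ` I) \<times> (\<alpha> ` I))\<^sup>* `` {\<alpha> i} \<in> dynkin_components \<alpha> \<alpha>v (\<alpha> ` I)"
        using i U(1) unfolding dynkin_components_def by blast
      ultimately show False
        using I unfolding weight_connected_def by blast
    qed
  next
    assume I: "mu_connected I"
    have False if K: "K \<in> dynkin_components \<alpha> \<alpha>v (\<alpha> ` I)" "K \<subseteq> orthogonal_simple_roots \<alpha> \<alpha>v \<mu>" for K
    proof -
      obtain i where i: "i \<in> I" "K = (dynkin_edges \<alpha> \<alpha>v \<inter> (\<alpha> ` I) \<times> (\<alpha> ` I))\<^sup>* `` {\<alpha> i}"
        using K(1) unfolding dynkin_components_def by blast
      \<comment> \<open>\<mu>-connectedness yields an edge leaving the index set of the component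
        \<open>K\<close>, which is impossible.\<close>
      define U where "U = {k \<in> I. \<alpha> k \<in> K}"
      have "i \<in> U"
        using i by (simp add: U_def)
      moreover have "\<forall>k\<in>U. blinfun_apply \<mu> (\<alpha>v k) = 0"
        using K(2) orth by (auto simp: U_def)
      moreover have "U \<subseteq> I"
        by (auto simp: U_def)
      ultimately obtain k j where kj: "k \<in> U" "j \<in> I - U" "A $ k $ j \<noteq> 0"
        using I unfolding mu_connected_def by blast
      then have "(\<alpha> k, \<alpha> j) \<in> dynkin_edges \<alpha> \<alpha>v \<inter> (\<alpha> ` I) \<times> (\<alpha> ` I)"
        using edge \<open>U \<subseteq> I\<close> by blast
      moreover have "(\<alpha> i, \<alpha> k) \<in> (dynkin_edges \<alpha> \<alpha>v \<inter> (\<alpha> ` I) \<times> (\<alpha> ` I))\<^sup>*"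
        using kj(1) i(2) by (simp add: U_def)
      ultimately have "\<alpha> j \<in> K"
        unfolding i(2) by (auto intro: rtrancl_into_rtrancl)
      then show False
        using kj(2) by (simp add: U_def)
    qed
    then show "weight_connected \<alpha> \<alpha>v \<mu> (\<alpha> ` I)"
      unfolding weight_connected_def by blast
  qed
  have sets: "{I. weight_connected \<alpha> \<alpha>v \<mu> I} = image \<alpha> ` {I. mu_connected I}"
  proof (rule subset_antisym)
    show "{I. weight_connected \<alpha> \<alpha>v \<mu> I} \<subseteq> image \<alpha> ` {I. mu_connected I}"
    proof
      fix J assume "J \<in> {I. weight_connected \<alpha> \<alpha>v \<mu> I}"
      moreover from this obtain I where "J = \<alpha> ` I"
        unfolding weight_connected_def subset_image_iff by blast
      ultimately show "J \<in> image \<alpha> ` {I. mu_connected I}"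
        using connected by blast
    qed
  qed (use connected in blast)

  have chamber: "x \<in> fundamental_chamber \<alpha> \<alpha>v \<longleftrightarrow> (\<forall>i. blinfun_apply x (\<alpha>v i) \<ge> 0)" for x
    by (auto simp: fundamental_chamber_def)
  have faces: "fundamental_faces \<alpha> \<alpha>v (hull_orbit UNIV) - {{}} = hull_orbit ` {I. mu_connected I}"
  proof (intro subset_antisym subsetI)
    fix F assume "F \<in> fundamental_faces \<alpha> \<alpha>v (hull_orbit UNIV) - {{}}"
    then obtain x where F: "F face_of hull_orbit UNIV" "x \<in> rel_interior F"
        "\<And>i. blinfun_apply x (\<alpha>v i) \<ge> 0"
      unfolding fundamental_faces_def using chamber by blast
    moreover have "x \<in> F"
      using F(2) rel_interior_subset by blast
    \<comment> \<open>A face of the hull that contains a relative interior point of \<open>F\<close>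
      contains all of \<open>F\<close>.\<close>
    moreover have "F \<subseteq> T" if "T face_of hull_orbit UNIV" "x \<in> T" for T
      using subset_of_face_of[OF that(1)] face_of_imp_subset[OF F(1)] F(2) that(2) by blast
    ultimately show "F \<in> hull_orbit ` {I. mu_connected I}"
      using minimal_face_at_dominant[of F x] by blast
  next
    fix F assume "F \<in> hull_orbit ` {I. mu_connected I}"
    then obtain I where I: "F = hull_orbit I" "mu_connected I"
      by blast
    then obtain d where d: "supp d = I" "wt d \<in> hull_orbit I" "\<And>i. blinfun_apply (wt d) (\<alpha>v i) \<ge> 0"
      using exists_dominant_full_support by blast
    have "wt d \<in> rel_interior (hull_orbit I)"
      using face_of_full_support[OF d] d(2) convex_hull_orbit
      by (intro rel_interior_faceI[OF bounded_linear_blinfun_coordinates inj_blinfun_coordinates])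
    then show "F \<in> fundamental_faces \<alpha> \<alpha>v (hull_orbit UNIV) - {{}}"
      using I(1) hull_orbit_face d(2,3) chamber unfolding fundamental_faces_def by blast
  qed

  have le: "\<alpha> ` I \<subseteq> \<alpha> ` J \<longleftrightarrow> hull_orbit I \<subseteq> hull_orbit J" if "mu_connected I" for I J
    using hull_orbit_le_iff[OF that] inj by (simp add: inj_image_subset_iff)
  \<comment> \<open>Injectivity follows from the order equivalence by antisymmetry of
    inclusion.\<close>
  then have "inj_on (\<lambda>I. orbit_hull (parabolic_subgroup \<alpha> \<alpha>v I) \<mu>) (image \<alpha> ` {I. mu_connected I})"
    unfolding inj_on_def by (simp add: hull set_eq_subset)
  then show ?thesis
    unfolding poset_isomorphism_def bij_betw_def sets hull_UNIV faces
    using le by (auto simp: image_image hull)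
qed

end
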